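(* Let $A\perp\!\!\!\perp B\mid C$ be a conditional independence statement, where $A,B,C$ are disjoint subsets of $[n]$. Then the ideal $J_{A\perp\!\!\!\perp B\mid C}$ is a symmetric Schubert determinantal ideal if and only if one of the following two conditions is satisfied: (1) $A=[1,i]$, $B=[j,n]$ and $C=\emptyset$, for some $i<j$; or (2) $A=[1,i]$, $B=[j,n]$ and $C=[i+1,j-1]$, for some $i<j-1$.
   Context: $[n]=\{1,\dots,n\}$ and $[a,b]=\{a,a+1,\dots,b\}$. $\Sigma=(\sigma_{ij})$, with $\sigma_{ij}=\sigma_{ji}$, is a symmetric $n\times n$ matrix of indeterminates, and $\Sigma_{S,T}$ denotes its submatrix with row index set $S$ and column index set $T$. For disjoint subsets $A,B,C\subseteq[n]$, the conditional independence statement $A\perp\!\!\!\perp B\mid C$ (read "$X_A$ is independent of $X_B$ given $X_C$", for an $n$-dimensional Gaussian random vector $X$ with covariance matrix $\Sigma$) has the associated conditional independence ideal $$J_{A\perp\!\!\!\perp B\mid C}=\langle (\#C+1)\text{-minors of }\Sigma_{A\cup C,\,B\cup C}\rangle\subseteq\mathbb{C}[\Sigma].$$ For a permutation $w\in S_n$, let $P(w)$ be the $n\times n$ permutation matrix with a $1$ in position $(i,j)$ if and only if $n+1-w(i)=j$, and let $R(w)_{ij}=\sum_{k=1}^{i}\sum_{l=j}^{n}P(w)_{kl}$. The symmetric Schubert determinantal ideal of $w$ is $$J_{\rm sym}(w)=\sum_{1\le i,j\le n}\langle (R(w)_{ij}+1)\text{-minors of }\Sigma_{[1,i],[j,n]}\rangle\subseteq\mathbb{C}[\Sigma],$$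 where an ideal of minors larger than the matrix containing them is the zero ideal. An ideal is called a symmetric Schubert determinantal ideal if it equals $J_{\rm sym}(w)$ for some $w\in S_n$.
   Formalization: The sets A and B are assumed nonempty, and conditions (1), (2) are read up to exchanging A and B; otherwise "only if" fails, e.g. for n=2, A={2}, B={1}, C=∅, or for A=∅, B={1}, C=∅. *)

theory Defs
  imports
    Complex_Main
    "HOL-Library.Poly_Mapping"
    "HOL-Library.Uprod"
    "HOL-Library.Set_Algebras"
    "HOL-Combinatorics.Permutations"
    "HOL-Algebra.Ideal"
    "Jordan_Normal_Form.Determinant"
    "Jordan_Normal_Form.DL_Submatrix"
begin

text \<open>
  Polynomials are finitely supported maps from monomials to complex coefficients, and monomials
  are finitely supported maps from indeterminates to exponents.  The indeterminates are unordered
  pairs (with repetition allowed), so that \<open>\<sigma> i j = \<sigma> j i\<close> holds by construction.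
\<close>

type_synonym cov_poly = "(nat uprod \<Rightarrow>\<^sub>0 nat) \<Rightarrow>\<^sub>0 complex"

definition cov_var :: "nat \<Rightarrow> nat \<Rightarrow> cov_poly" (\<open>\<sigma>\<close>) where
  "\<sigma> i j = Poly_Mapping.single (Poly_Mapping.single (Upair i j) 1) 1"

text \<open>
  The type \<open>cov_poly\<close> has infinitely many indeterminates.  The ring \<open>\<complex>[\<Sigma>]\<close> consists of the
  polynomials in which only \<open>\<sigma> i j\<close> with \<open>i, j \<in> [n]\<close> occur; all ideals below are ideals of it.
\<close>

definition cov_ring :: "nat \<Rightarrow> cov_poly ring" where
  "cov_ring n =
     \<lparr>carrier = {p. \<forall>m \<in> Poly_Mapping.keys p. Poly_Mapping.keys m \<subseteq> {Upair i j | i j. i \<in> {1..n} \<and> j \<in> {1..n}}},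
      monoid.mult = (*), one = 1, zero = 0, add = (+)\<rparr>"

definition cov_mat :: "nat \<Rightarrow> cov_poly mat" where
  "cov_mat n = mat n n (\<lambda>(i, j). \<sigma> (Suc i) (Suc j))"

text \<open>
  Matrices of type \<open>mat\<close> are indexed from \<open>0\<close>, whereas \<open>S, T \<subseteq> [n]\<close>; hence the shift by \<open>Suc\<close>.
\<close>

definition cov_submat :: "nat \<Rightarrow> nat set \<Rightarrow> nat set \<Rightarrow> cov_poly mat" where
  "cov_submat n S T = submatrix (cov_mat n) (Suc -` S) (Suc -` T)"

definition minors :: "nat \<Rightarrow> 'a :: comm_ring_1 mat \<Rightarrow> 'a set" where
  "minors k M = {det (submatrix M I J) | I J.
     I \<subseteq> {..<dim_row M} \<and> J \<subseteq> {..<dim_col M} \<and> card I = k \<and> card J = k}"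

definition ci_ideal :: "nat \<Rightarrow> nat set \<Rightarrow> nat set \<Rightarrow> nat set \<Rightarrow> cov_poly set" where
  "ci_ideal n A B C = Idl\<^bsub>cov_ring n\<^esub> (minors (card C + 1) (cov_submat n (A \<union> C) (B \<union> C)))"

definition schubert_perm_mat :: "nat \<Rightarrow> (nat \<Rightarrow> nat) \<Rightarrow> nat \<Rightarrow> nat \<Rightarrow> nat" where
  "schubert_perm_mat n w i j = (if n + 1 - w i = j then 1 else 0)"

definition schubert_rank :: "nat \<Rightarrow> (nat \<Rightarrow> nat) \<Rightarrow> nat \<Rightarrow> nat \<Rightarrow> nat" where
  "schubert_rank n w i j = (\<Sum>k = 1..i. \<Sum>l = j..n. schubert_perm_mat n w k l)"

text \<open>
  The outer sums below are sums of subsets of \<open>cov_poly\<close> (elementwise, from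
  \<^theory>\<open>HOL-Library.Set_Algebras\<close>), that is, sums of ideals.
\<close>

definition sym_schubert_ideal :: "nat \<Rightarrow> (nat \<Rightarrow> nat) \<Rightarrow> cov_poly set" where
  "sym_schubert_ideal n w =
     (\<Sum>i = 1..n. \<Sum>j = 1..n.
        Idl\<^bsub>cov_ring n\<^esub> (minors (schubert_rank n w i j + 1) (cov_submat n {1..i} {j..n})))"

definition is_sym_schubert_ideal :: "nat \<Rightarrow> cov_poly set \<Rightarrow> bool" where
  "is_sym_schubert_ideal n I \<longleftrightarrow> (\<exists>w. w permutes {1..n} \<and> I = sym_schubert_ideal n w)"

text \<open>
  A conditional independence statement has nonempty sides: for \<open>A = {}\<close> or \<open>B = {}\<close> the statement
  is vacuous and its ideal is zero, which is the symmetric Schubert determinantal ideal of the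
  identity permutation.
\<close>

definition ci_statement :: "nat \<Rightarrow> nat set \<Rightarrow> nat set \<Rightarrow> nat set \<Rightarrow> bool" where
  "ci_statement n A B C \<longleftrightarrow>
     A \<subseteq> {1..n} \<and> B \<subseteq> {1..n} \<and> C \<subseteq> {1..n} \<and>
     A \<inter> B = {} \<and> A \<inter> C = {} \<and> B \<inter> C = {} \<and> A \<noteq> {} \<and> B \<noteq> {}"

text \<open>
  The two sides of a conditional independence statement are interchangeable, and
  \<open>ci_ideal n A B C = ci_ideal n B A C\<close> since \<open>\<Sigma>\<close> is symmetric.  The conditions below refer to one
  way of ordering the sides, so they are to be read up to exchanging \<open>A\<close> and \<open>B\<close>.
\<close>

definition interval_ci :: "nat \<Rightarrow> nat set \<Rightarrow> nat set \<Rightarrow> nat set \<Rightarrow> bool" where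
  "interval_ci n A B C \<longleftrightarrow>
     (\<exists>i \<in> {1..n}. \<exists>j \<in> {1..n}. i < j \<and> A = {1..i} \<and> B = {j..n} \<and> C = {}) \<or>
     (\<exists>i \<in> {1..n}. \<exists>j \<in> {1..n}. i < j - 1 \<and> A = {1..i} \<and> B = {j..n} \<and> C = {i+1..j-1})"

end

theory Submission
  imports Defs
begin

text \<open>
  Both interval conditions ask for rank at most \<open>c = #C\<close> on a corner \<open>[1, p] \<times> [q, n]\<close> of \<open>\<Sigma>\<close> with
  \<open>p + 1 \<le> c + q\<close>: without \<open>C\<close>, \<open>p = i\<close> and \<open>q = j\<close>; with \<open>C = [i+1, j-1]\<close>, \<open>p = j - 1\<close> and
  \<open>q = i + 1\<close>.  Such a condition is Schubert, by \<open>block_ideal_is_sym_schubert_ideal\<close>.  The permutation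
  exchanges two adjacent blocks; its rank function has the value \<open>c\<close> at \<open>(p, q)\<close>, and at every
  other corner it is as large as the rank bound at \<open>(p, q)\<close> permits.  The remaining minors are then in the ideal of the
  \<open>(c+1)\<close>-minors of the one corner by Laplace expansion (\<open>cov_minor_block_in_ideal\<close>).

  Conversely, a conditional independence ideal that is Schubert is compared with the Schubert ideal
  through the indeterminates that occur in degree \<open>c + 1\<close>, the lowest degree of its elements.  On the
  conditional independence side these are the entries of \<open>\<Sigma>\<^bsub>A\<union>C,B\<union>C\<^esub>\<close>
  (\<open>vars_in_degree_ci_ideal\<close>).  On the Schubert side they are the entries of the corners of rank \<open>c\<close>
  whose condition is not vacuous (\<open>vars_in_degree_sym_schubert_ideal\<close>).  Equality of the two sets
  forces \<open>A \<union> C\<close> and \<open>B \<union> C\<close> to be an initial and a final segment of \<open>[n]\<close>, in one order or the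
  other (\<open>interval_ci_of_cov_vars\<close>).

  The computation of these indeterminates needs that no entry of a block cancels from all of its
  minors.  That is not automatic for a symmetric matrix, where different permutations can contribute
  the same monomial; \<open>minor_with_var\<close> chooses the minor and the monomial so that it occurs only once.
\<close>

section \<open>The polynomial ring and its ideals\<close>

text \<open>
  The polynomials all of whose monomials lie in \<open>P\<close>.  The carrier of \<open>\<complex>[\<Sigma>]\<close> is of this form, and so
  are the homogeneous polynomials of given degree in given variables.
\<close>

definition monom_span :: "(nat uprod \<Rightarrow>\<^sub>0 nat) set \<Rightarrow> cov_poly set" where
  "monom_span P = {p. Poly_Mapping.keys p \<subseteq> P}"

lemma monom_span_zero: "0 \<in> monom_span P"
  by (simp add: monom_span_def)

lemma monom_span_add: "p \<in> monom_span P \<Longrightarrow> q \<in> monom_span P \<Longrightarrow> p + q \<in> monom_span P"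
  using keys_add[of p q] by (auto simp: monom_span_def)

lemma monom_span_uminus: "p \<in> monom_span P \<Longrightarrow> - p \<in> monom_span P"
  by (simp add: monom_span_def)

lemma monom_span_sum: "(\<And>a. a \<in> X \<Longrightarrow> f a \<in> monom_span P) \<Longrightarrow> sum f X \<in> monom_span P"
  by (induction X rule: infinite_finite_induct) (auto simp: monom_span_zero monom_span_add)

lemma monom_span_mult:
  assumes "p \<in> monom_span P" "q \<in> monom_span Q" "\<And>a b. a \<in> P \<Longrightarrow> b \<in> Q \<Longrightarrow> a + b \<in> R"
  shows "p * q \<in> monom_span R"
  using keys_mult[of p q] assms by (fastforce simp: monom_span_def)

text \<open>The total degree of a monomial.\<close>

definition mon_deg :: "(nat uprod \<Rightarrow>\<^sub>0 nat) \<Rightarrow> nat" where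
  "mon_deg m = (\<Sum>u \<in> Poly_Mapping.keys m. Poly_Mapping.lookup m u)"

lemma mon_deg_zero [simp]: "mon_deg 0 = 0"
  by (simp add: mon_deg_def)

lemma mon_deg_single [simp]: "mon_deg (Poly_Mapping.single u k) = k"
  by (simp add: mon_deg_def)

lemma mon_deg_add: "mon_deg (a + b) = mon_deg a + mon_deg b"
  unfolding mon_deg_def by (rule setsum_keys_plus_distrib) auto

lemma mon_deg_eq_0_iff: "mon_deg m = 0 \<longleftrightarrow> m = 0"
proof
  assume "mon_deg m = 0"
  then have "Poly_Mapping.lookup m u = 0" for u
    by (cases "u \<in> Poly_Mapping.keys m") (auto simp: mon_deg_def in_keys_iff)
  then show "m = 0" by (intro poly_mapping_eqI) simp
qed simp

lemma keys_add_nat: "Poly_Mapping.keys (a + b) = Poly_Mapping.keys a \<union> Poly_Mapping.keys (b :: 'a \<Rightarrow>\<^sub>0 nat)"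
  by (auto simp: in_keys_iff lookup_add)

text \<open>The indeterminates that occur in the submatrix \<open>\<Sigma>\<^bsub>S,T\<^esub>\<close>.\<close>

definition cov_vars :: "nat set \<Rightarrow> nat set \<Rightarrow> nat uprod set" where
  "cov_vars S T = {Upair i j | i j. i \<in> S \<and> j \<in> T}"

lemma carrier_cov_ring: "carrier (cov_ring n) = monom_span {m. Poly_Mapping.keys m \<subseteq> cov_vars {1..n} {1..n}}"
  by (auto simp: cov_ring_def monom_span_def cov_vars_def)

lemma cov_ring_simps [simp]:
  "x \<otimes>\<^bsub>cov_ring n\<^esub> y = x * y" "\<one>\<^bsub>cov_ring n\<^esub> = 1" "\<zero>\<^bsub>cov_ring n\<^esub> = 0" "x \<oplus>\<^bsub>cov_ring n\<^esub> y = x + y"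
  by (simp_all add: cov_ring_def)

lemma cov_ring_closed:
  "0 \<in> carrier (cov_ring n)" "1 \<in> carrier (cov_ring n)"
  "p \<in> carrier (cov_ring n) \<Longrightarrow> q \<in> carrier (cov_ring n) \<Longrightarrow> p + q \<in> carrier (cov_ring n)"
  "p \<in> carrier (cov_ring n) \<Longrightarrow> - p \<in> carrier (cov_ring n)"
  "p \<in> carrier (cov_ring n) \<Longrightarrow> q \<in> carrier (cov_ring n) \<Longrightarrow> p * q \<in> carrier (cov_ring n)"
proof -
  show "p \<in> carrier (cov_ring n) \<Longrightarrow> q \<in> carrier (cov_ring n) \<Longrightarrow> p * q \<in> carrier (cov_ring n)"
    unfolding carrier_cov_ring by (erule monom_span_mult, assumption) (auto simp: keys_add_nat)
  show "1 \<in> carrier (cov_ring n)"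
    unfolding carrier_cov_ring by (simp add: monom_span_def)
qed (unfold carrier_cov_ring, auto simp: monom_span_zero monom_span_add monom_span_uminus)

lemma cring_cov_ring: "cring (cov_ring n)"
proof (rule cringI)
  show "abelian_group (cov_ring n)"
  proof (rule abelian_groupI)
    fix p assume "p \<in> carrier (cov_ring n)"
    then show "\<exists>q \<in> carrier (cov_ring n). q \<oplus>\<^bsub>cov_ring n\<^esub> p = \<zero>\<^bsub>cov_ring n\<^esub>"
      by (intro bexI[of _ "- p"]) (auto simp: cov_ring_closed)
  qed (auto simp: cov_ring_closed algebra_simps)
  show "comm_monoid (cov_ring n)"
    by (rule comm_monoidI) (auto simp: cov_ring_closed algebra_simps)
qed (auto simp: algebra_simps)

lemma ring_cov_ring: "ring (cov_ring n)"
  using cring_cov_ring by (simp add: cring_def)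

lemma cov_idealI:
  assumes "I \<subseteq> carrier (cov_ring n)" "0 \<in> I" "\<And>p q. p \<in> I \<Longrightarrow> q \<in> I \<Longrightarrow> p + q \<in> I"
    "\<And>p. p \<in> I \<Longrightarrow> - p \<in> I" "\<And>p r. p \<in> I \<Longrightarrow> r \<in> carrier (cov_ring n) \<Longrightarrow> r * p \<in> I"
  shows "ideal I (cov_ring n)"
proof (rule idealI[OF ring_cov_ring])
  interpret ring "cov_ring n" by (rule ring_cov_ring)
  show "subgroup I (add_monoid (cov_ring n))"
  proof (rule add.subgroupI)
    fix p assume p: "p \<in> I"
    then have "\<ominus>\<^bsub>cov_ring n\<^esub> p = - p"
      using assms(1,4) by (intro minus_equality) auto
    with p assms(4) show "\<ominus>\<^bsub>cov_ring n\<^esub> p \<in> I" by simp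
  qed (use assms(1-3) in auto)
qed (use assms in \<open>auto simp: mult.commute\<close>)

lemma cov_ideal_closed:
  assumes "ideal I (cov_ring n)"
  shows "0 \<in> I" "p \<in> I \<Longrightarrow> q \<in> I \<Longrightarrow> p + q \<in> I" "p \<in> I \<Longrightarrow> - p \<in> I"
    "p \<in> I \<Longrightarrow> r \<in> carrier (cov_ring n) \<Longrightarrow> r * p \<in> I"
    "I \<subseteq> carrier (cov_ring n)"
proof -
  interpret ideal I "cov_ring n" by fact
  show "0 \<in> I" using additive_subgroup.zero_closed[OF is_additive_subgroup] by simp
  show "p \<in> I \<Longrightarrow> q \<in> I \<Longrightarrow> p + q \<in> I" using additive_subgroup.a_closed[OF is_additive_subgroup, of p q] by simp
  show mult: "p \<in> I \<Longrightarrow> r \<in> carrier (cov_ring n) \<Longrightarrow> r * p \<in> I" for p r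
    using I_l_closed[of p r] by simp
  show "p \<in> I \<Longrightarrow> - p \<in> I" 
    using mult[of p "- 1"] by (simp add: cov_ring_closed)
  show "I \<subseteq> carrier (cov_ring n)" by (rule a_subset)
qed

lemma cov_ideal_sum:
  assumes "ideal I (cov_ring n)" "\<And>a. a \<in> X \<Longrightarrow> f a \<in> I"
  shows "sum f X \<in> I"
  using assms(2)
  by (induction X rule: infinite_finite_induct) (auto simp: cov_ideal_closed[OF assms(1)])

lemma Idl_subset_iff:
  assumes "ideal I (cov_ring n)" "G \<subseteq> carrier (cov_ring n)"
  shows "Idl\<^bsub>cov_ring n\<^esub> G \<subseteq> I \<longleftrightarrow> G \<subseteq> I"
  using ring.genideal_minimal[OF ring_cov_ring assms(1)] 
    ring.genideal_self[OF ring_cov_ring assms(2)] by blast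

lemma sum_ideals_subset:
  assumes "ideal I (cov_ring n)" "\<And>a. a \<in> X \<Longrightarrow> F a \<subseteq> I"
  shows "sum F X \<subseteq> I"
  using assms(2)
proof (induction X rule: infinite_finite_induct)
  case (insert x X)
  then show ?case
    by (auto simp: set_plus_def intro!: cov_ideal_closed[OF assms(1)] )
qed (auto simp: cov_ideal_closed[OF assms(1)])

text \<open>
  The hypothesis on \<open>0\<close> is needed: a sum of sets is empty as soon as one summand is empty.
\<close>

lemma subset_sum_sets:
  fixes F :: "'b \<Rightarrow> 'a :: comm_monoid_add set"
  assumes "finite X" "a \<in> X" "\<And>b. b \<in> X \<Longrightarrow> 0 \<in> F b"
  shows "F a \<subseteq> sum F X" 
proof -
  have "0 \<in> sum F Y" if "Y \<subseteq> X" for Y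
  proof -
    have "finite Y" using that assms(1) finite_subset by blast
    then show ?thesis using that
    proof (induction Y)
      case (insert y Y)
      then have "0 \<in> F y" "0 \<in> sum F Y" using assms(3) by auto
      then have "0 + 0 \<in> F y + sum F Y" by (rule set_plus_intro)
      then show ?case using insert by simp
    qed simp
  qed
  then have z: "0 \<in> sum F (X - {a})" by simp
  have "sum F X = F a + sum F (X - {a})"
    using assms by (simp add: sum.remove)
  moreover have "x \<in> F a + sum F (X - {a})" if "x \<in> F a" for x
    using set_plus_intro[OF that z] by simp
  ultimately show ?thesis by auto
qed

section \<open>Minors of the covariance matrix\<close>

text \<open>
  The minor with rows \<open>f 0, \<dots>, f (k - 1)\<close> and columns \<open>g 0, \<dots>, g (k - 1)\<close>.  Rows and columns may be
  listed in any order, and even with repetitions; this makes Laplace expansion a statement about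
  composition with \<open>skip\<close>.  Up to sign these are \<open>0\<close> or the minors in the sense of \<open>minors\<close>.
\<close>

definition cov_minor :: "nat \<Rightarrow> (nat \<Rightarrow> nat) \<Rightarrow> (nat \<Rightarrow> nat) \<Rightarrow> cov_poly" where
  "cov_minor k f g = det (mat k k (\<lambda>(a, b). \<sigma> (f a) (g b)))"

lemma cov_var_commute: "\<sigma> i j = \<sigma> j i"
proof -
  have "Upair i j = Upair j i" by simp
  then show ?thesis by (simp only: cov_var_def)
qed

lemma cov_minor_commute: "cov_minor k f g = cov_minor k g f"
proof -
  let ?M = "mat k k (\<lambda>(a, b). \<sigma> (f a) (g b))"
  have "cov_minor k g f = det (transpose_mat ?M)"
    unfolding cov_minor_def by (intro arg_cong[of _ _ det] eq_matI) (auto simp: cov_var_commute)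
  also have "\<dots> = det ?M" by (rule det_transpose[of _ k]) simp
  finally show ?thesis by (simp add: cov_minor_def)
qed

lemma cov_minor_cong:
  "(\<And>a. a < k \<Longrightarrow> f a = f' a) \<Longrightarrow> (\<And>a. a < k \<Longrightarrow> g a = g' a) \<Longrightarrow> cov_minor k f g = cov_minor k f' g'"
  unfolding cov_minor_def by (intro arg_cong[of _ _ det] eq_matI) auto

lemma cov_minor_permute:
  assumes "p permutes {0..<k}"
  shows "cov_minor k (f \<circ> p) g = signof p * cov_minor k f g"
proof -
  let ?M = "mat k k (\<lambda>(a, b). \<sigma> (f a) (g b))"
  have "cov_minor k (f \<circ> p) g = det (mat k k (\<lambda>(i, j). ?M $$ (p i, j)))"
    unfolding cov_minor_def using permutes_in_image[OF assms]
    by (intro arg_cong[of _ _ det] eq_matI) auto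
  also have "\<dots> = signof p * det ?M"
    using assms by (intro det_permute_rows) auto
  finally show ?thesis by (simp add: cov_minor_def)
qed

lemma cov_minor_not_inj:
  assumes "\<not> inj_on f {..<k}"
  shows "cov_minor k f g = 0"
proof -
  let ?M = "mat k k (\<lambda>(a, b). \<sigma> (f a) (g b))"
  from assms obtain i j where "i < k" "j < k" "i \<noteq> j" "f i = f j"
    by (auto simp: inj_on_def)
  then have "row ?M i = row ?M j" by (intro eq_vecI) auto
  with \<open>i < k\<close> \<open>j < k\<close> \<open>i \<noteq> j\<close> have "det ?M = 0"
    by (intro det_identical_rows[of _ k i j]) auto
  then show ?thesis by (simp add: cov_minor_def)
qed

text \<open>The increasing enumeration of all naturals other than \<open>a\<close>.\<close>

definition skip :: "nat \<Rightarrow> nat \<Rightarrow> nat" where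
  "skip a b = (if b < a then b else Suc b)"

lemma cov_minor_expand_row:
  assumes "a < Suc k"
  shows "cov_minor (Suc k) f g =
    (\<Sum>b < Suc k. \<sigma> (f a) (g b) * ((- 1) ^ (a + b) * cov_minor k (f \<circ> skip a) (g \<circ> skip b)))"
proof -
  let ?M = "mat (Suc k) (Suc k) (\<lambda>(a, b). \<sigma> (f a) (g b))"
  have "det (mat_delete ?M a b) = cov_minor k (f \<circ> skip a) (g \<circ> skip b)" if "b < Suc k" for b
    unfolding cov_minor_def mat_delete_def using that assms
    by (intro arg_cong[of _ _ det] eq_matI) (auto simp: skip_def)
  then show ?thesis
    unfolding cov_minor_def[of "Suc k"] using laplace_expansion_row[of ?M "Suc k" a] assms
    by (simp add: cofactor_def del: sum.lessThan_Suc)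
qed

text \<open>
  The elements of \<open>S\<close> in increasing order.  The argument counts from \<open>0\<close> and the shift by \<open>Suc\<close> undoes
  the one in \<open>cov_submat\<close>, so this is meaningful only for \<open>0 \<notin> S\<close>.
\<close>

definition nth_elem :: "nat set \<Rightarrow> nat \<Rightarrow> nat" where
  "nth_elem S a = Suc (pick (Suc -` S) a)"

lemma subset_range_Suc: "S \<subseteq> {1..n} \<Longrightarrow> S \<subseteq> range Suc"
proof
  fix x assume "S \<subseteq> {1..n}" "x \<in> S"
  then have "x = Suc (x - 1)" by auto
  then show "x \<in> range Suc" by (rule range_eqI)
qed

lemma card_Suc_vimage: "S \<subseteq> {1..n} \<Longrightarrow> card (Suc -` S) = card S"
  by (rule card_vimage_inj) (auto simp: subset_range_Suc)

lemma pick_bij_betw: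
  assumes "finite S"
  shows "bij_betw (pick S) {..<card S} S"
proof -
  have inj: "inj_on (pick S) {..<card S}"
  proof (rule inj_onI)
    fix a b assume "a \<in> {..<card S}" "b \<in> {..<card S}" "pick S a = pick S b"
    then show "a = b"
      using pick_mono_le[of a S b] pick_mono_le[of b S a] by (cases a b rule: linorder_cases) auto
  qed
  moreover have "pick S ` {..<card S} = S"
    using inj assms by (intro card_subset_eq) (auto simp: card_image pick_in_set_le)
  ultimately show ?thesis by (simp add: bij_betw_def)
qed

lemma nth_elem_bij_betw:
  assumes "S \<subseteq> {1..n}"
  shows "bij_betw (nth_elem S) {..<card S} S"
proof -
  have "finite S" using assms finite_subset by blast
  then have "bij_betw (pick (Suc -` S)) {..<card S} (Suc -` S)"
    using pick_bij_betw[of "Suc -` S"] card_Suc_vimage[OF assms] by (simp add: finite_vimageI)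
  moreover have "bij_betw Suc (Suc -` S) S"
    using subset_range_Suc[OF assms] by (auto simp: bij_betw_def)
  ultimately have "bij_betw (Suc \<circ> pick (Suc -` S)) {..<card S} S"
    by (rule bij_betw_trans)
  then show ?thesis
    by (rule bij_betw_cong[THEN iffD1, rotated]) (simp add: nth_elem_def)
qed

lemma dim_cov_submat:
  assumes "S \<subseteq> {1..n}" "T \<subseteq> {1..n}"
  shows "dim_row (cov_submat n S T) = card S" "dim_col (cov_submat n S T) = card T"
proof -
  have *: "{i. i < n \<and> Suc i \<in> S} = Suc -` S" if "S \<subseteq> {1..n}" for S
    using that by auto
  show "dim_row (cov_submat n S T) = card S" "dim_col (cov_submat n S T) = card T"
    using assms by (simp_all add: cov_submat_def dim_submatrix cov_mat_def * card_Suc_vimage)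
qed

lemma cov_submat_index:
  assumes "S \<subseteq> {1..n}" "T \<subseteq> {1..n}" "a < card S" "b < card T"
  shows "cov_submat n S T $$ (a, b) = \<sigma> (nth_elem S a) (nth_elem T b)"
proof -
  have *: "{i. i < n \<and> i \<in> Suc -` S} = Suc -` S" if "S \<subseteq> {1..n}" for S
    using that by auto
  have "nth_elem S a \<in> S" "nth_elem T b \<in> T"
    using assms bij_betwE[OF nth_elem_bij_betw] by blast+
  then have "nth_elem S a \<le> n" "nth_elem T b \<le> n" using assms by auto
  then have "pick (Suc -` S) a < n" "pick (Suc -` T) b < n" by (auto simp: nth_elem_def)
  then show ?thesis
    unfolding cov_submat_def using assms
    by (subst submatrix_index) (auto simp: cov_mat_def * card_Suc_vimage nth_elem_def simp del: vimage_eq)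
qed

lemma det_submatrix_cov_submat:
  assumes "S \<subseteq> {1..n}" "T \<subseteq> {1..n}"
    "I \<subseteq> {..<card S}" "J \<subseteq> {..<card T}" "card I = k" "card J = k"
  shows "det (submatrix (cov_submat n S T) I J) =
    cov_minor k (nth_elem S \<circ> pick I) (nth_elem T \<circ> pick J)"
proof -
  have I: "{i. i < card S \<and> i \<in> I} = I" and J: "{j. j < card T \<and> j \<in> J} = J"
    using assms by auto
  have "pick I a < card S" "pick J a < card T" if "a < k" for a
    using assms that pick_in_set_le[of a I] pick_in_set_le[of a J] by auto
  then show ?thesis
    unfolding cov_minor_def submatrix_def using assms
    by (intro arg_cong[of _ _ det] eq_matI) (auto simp: dim_cov_submat I J cov_submat_index)
qed

lemma minors_cov_submatE:
  assumes "S \<subseteq> {1..n}" "T \<subseteq> {1..n}" "p \<in> minors k (cov_submat n S T)"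
  obtains f g where "p = cov_minor k f g" "inj_on f {..<k}" "f ` {..<k} \<subseteq> S"
    "inj_on g {..<k}" "g ` {..<k} \<subseteq> T"
proof -
  from assms obtain I J where IJ: "I \<subseteq> {..<card S}" "J \<subseteq> {..<card T}" "card I = k" "card J = k"
    "p = det (submatrix (cov_submat n S T) I J)"
    by (auto simp: minors_def dim_cov_submat)
  have *: "inj_on (nth_elem S \<circ> pick I) {..<k} \<and> (nth_elem S \<circ> pick I) ` {..<k} \<subseteq> S"
    if "S \<subseteq> {1..n}" "I \<subseteq> {..<card S}" "card I = k" for S I
  proof -
    have "bij_betw (pick I) {..<k} I"
      using that pick_bij_betw finite_subset by blast
    moreover have "inj_on (nth_elem S) I" "nth_elem S ` I \<subseteq> S"
      using nth_elem_bij_betw[OF that(1)] that(2) by (auto simp: bij_betw_def intro: inj_on_subset)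
    ultimately show ?thesis by (auto simp: bij_betw_def intro: comp_inj_on)
  qed
  show ?thesis
  proof (rule that)
    show "p = cov_minor k (nth_elem S \<circ> pick I) (nth_elem T \<circ> pick J)"
      using IJ assms by (simp add: det_submatrix_cov_submat)
  qed (use *[OF assms(1) IJ(1,3)] *[OF assms(2) IJ(2,4)] in auto)
qed

text \<open>
  An injective list of elements of \<open>S\<close> is a rearrangement of the increasing list that the selection
  of rows \<open>I\<close> in a matrix with row index set \<open>S\<close> produces.
\<close>

lemma selection_sorted:
  assumes "S \<subseteq> {1..n}" "f ` {..<k} \<subseteq> S" "inj_on f {..<k}"
  obtains I p where "I \<subseteq> {..<card S}" "card I = k" "p permutes {0..<k}"
    "\<And>a. a < k \<Longrightarrow> nth_elem S (pick I a) = f (p a)"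
proof -
  define I where "I = {i. i < card S \<and> nth_elem S i \<in> f ` {..<k}}"
  have bS: "bij_betw (nth_elem S) {..<card S} S" by (rule nth_elem_bij_betw[OF assms(1)])
  have I: "I \<subseteq> {..<card S}" by (auto simp: I_def)
  have "nth_elem S ` I = f ` {..<k}"
  proof
    show "f ` {..<k} \<subseteq> nth_elem S ` I"
    proof
      fix y assume y: "y \<in> f ` {..<k}"
      then have "y \<in> nth_elem S ` {..<card S}" using bS assms(2) by (auto simp: bij_betw_def)
      then obtain i where "i < card S" "y = nth_elem S i" by auto
      with y show "y \<in> nth_elem S ` I" by (intro image_eqI[of _ _ i]) (auto simp: I_def)
    qed
  qed (auto simp: I_def)
  moreover have "inj_on (nth_elem S) I"
    using bS I by (auto simp: bij_betw_def intro: inj_on_subset)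
  ultimately have bI: "bij_betw (nth_elem S) I (f ` {..<k})" by (simp add: bij_betw_def)
  then have card: "card I = k"
    using bij_betw_same_card[OF bI] assms(3) by (simp add: card_image)
  have "bij_betw (pick I) {..<k} I"
    using pick_bij_betw[of I] card I finite_subset by blast
  then have h: "bij_betw (nth_elem S \<circ> pick I) {..<k} (f ` {..<k})"
    using bI by (rule bij_betw_trans)
  have f: "bij_betw f {..<k} (f ` {..<k})" using assms(3) by (simp add: bij_betw_def)
  define q where "q = inv_into {..<k} f \<circ> (nth_elem S \<circ> pick I)"
  have q: "bij_betw q {..<k} {..<k}"
    unfolding q_def using h bij_betw_inv_into[OF f] by (rule bij_betw_trans)
  define p where "p a = (if a < k then q a else a)" for a
  have "bij_betw p {0..<k} {0..<k}"
    using q by (subst bij_betw_cong[of _ _ q]) (auto simp: p_def atLeast0LessThan)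
  then have "p permutes {0..<k}"
    by (rule bij_imp_permutes) (simp add: p_def)
  moreover have "nth_elem S (pick I a) = f (p a)" if "a < k" for a
  proof -
    have "nth_elem S (pick I a) \<in> f ` {..<k}" using h that by (auto simp: bij_betw_def)
    then show ?thesis using that by (simp add: p_def q_def f_inv_into_f)
  qed
  ultimately show ?thesis using that I card by blast
qed

lemma cov_ideal_signof:
  assumes "ideal I (cov_ring n)" "p \<in> I"
  shows "signof \<pi> * p \<in> I"
  using cov_ideal_closed(3)[OF assms(1)] assms(2) by (cases "sign \<pi> = (1 :: int)") (auto simp: sign_def)

lemma cov_minor_in_ideal:
  assumes "ideal I (cov_ring n)" "minors k (cov_submat n S T) \<subseteq> I" "S \<subseteq> {1..n}" "T \<subseteq> {1..n}"
    "f ` {..<k} \<subseteq> S" "g ` {..<k} \<subseteq> T"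
  shows "cov_minor k f g \<in> I"
proof (cases "inj_on f {..<k} \<and> inj_on g {..<k}")
  case False
  then have "cov_minor k f g = 0"
    using cov_minor_not_inj[of f k g] cov_minor_not_inj[of g k f] cov_minor_commute[of k f g] by auto
  then show ?thesis using cov_ideal_closed[OF assms(1)] by simp
next
  case True
  obtain K p where K: "K \<subseteq> {..<card S}" "card K = k" "p permutes {0..<k}"
    "\<And>a. a < k \<Longrightarrow> nth_elem S (pick K a) = f (p a)"
    using selection_sorted[OF assms(3,5)] True by blast
  obtain J q where J: "J \<subseteq> {..<card T}" "card J = k" "q permutes {0..<k}"
    "\<And>a. a < k \<Longrightarrow> nth_elem T (pick J a) = g (q a)"
    using selection_sorted[OF assms(4,6)] True by blast
  have ss: "signof p * (signof p * x) = x" for x :: cov_poly and p :: "nat \<Rightarrow> nat"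
    by (cases "sign p = (1 :: int)") (auto simp: sign_def)
  have "det (submatrix (cov_submat n S T) K J) = cov_minor k (f \<circ> p) (g \<circ> q)"
    using assms K J by (simp add: det_submatrix_cov_submat) (rule cov_minor_cong, auto)
  also have "\<dots> = signof p * (signof q * cov_minor k f g)"
    by (simp only: cov_minor_permute[OF K(3)] cov_minor_permute[OF J(3)] cov_minor_commute[of k f])
  finally have "cov_minor k f g = signof q * (signof p * det (submatrix (cov_submat n S T) K J))"
    by (simp add: ss)
  moreover have "det (submatrix (cov_submat n S T) K J) \<in> minors k (cov_submat n S T)"
    using K J assms by (auto simp: minors_def dim_cov_submat)
  ultimately show ?thesis using assms(1,2) by (auto intro!: cov_ideal_signof)
qed

section \<open>The monomials of a minor\<close>

lemma prod_cov_var: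
  "finite X \<Longrightarrow> (\<Prod>a \<in> X. \<sigma> (f a) (g a)) =
    Poly_Mapping.single (\<Sum>a \<in> X. Poly_Mapping.single (Upair (f a) (g a)) 1) 1"
  by (induction X rule: finite_induct) (auto simp: cov_var_def mult_single)

text \<open>The Leibniz expansion, with each product of indeterminates written as a single monomial.\<close>

lemma cov_minor_eq_sum:
  "cov_minor k f g = (\<Sum>p | p permutes {0..<k}.
     signof p * Poly_Mapping.single (\<Sum>a = 0..<k. Poly_Mapping.single (Upair (f a) (g (p a))) 1) 1)"
proof -
  have "(\<Prod>i = 0..<k. mat k k (\<lambda>(a, b). \<sigma> (f a) (g b)) $$ (i, p i)) = (\<Prod>i = 0..<k. \<sigma> (f i) (g (p i)))"
    if "p permutes {0..<k}" for p
    using permutes_in_image[OF that] by (intro prod.cong) auto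
  then show ?thesis
    unfolding cov_minor_def
    by (subst det_def'[of _ k]) (auto intro!: sum.cong simp: prod_cov_var)
qed

lemma mon_deg_sum: "mon_deg (sum h X) = (\<Sum>a \<in> X. mon_deg (h a))"
  by (induction X rule: infinite_finite_induct) (auto simp: mon_deg_add)

lemma keys_sum_nat: "finite X \<Longrightarrow> Poly_Mapping.keys (sum h X) = (\<Union>a \<in> X. Poly_Mapping.keys (h a :: 'a \<Rightarrow>\<^sub>0 nat))"
  by (induction X rule: finite_induct) (auto simp: keys_add_nat)

lemma cov_minor_monom_span:
  assumes "f ` {..<k} \<subseteq> S" "g ` {..<k} \<subseteq> T"
  shows "cov_minor k f g \<in> monom_span {m. mon_deg m = k \<and> Poly_Mapping.keys m \<subseteq> cov_vars S T}"
  unfolding cov_minor_eq_sum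
proof (rule monom_span_sum)
  fix p assume "p \<in> {p. p permutes {0..<k}}"
  then have p: "p a < k" if "a < k" for a
    using permutes_in_image[of p "{0..<k}"] that by auto
  let ?m = "\<Sum>a = 0..<k. Poly_Mapping.single (Upair (f a) (g (p a))) 1 :: nat uprod \<Rightarrow>\<^sub>0 nat"
  have "mon_deg ?m = k" by (simp add: mon_deg_sum)
  moreover have "Poly_Mapping.keys ?m \<subseteq> cov_vars S T"
  proof -
    have "Upair (f a) (g (p a)) \<in> cov_vars S T" if "a < k" for a
    proof -
      have "f a \<in> S" "g (p a) \<in> T" using assms p[OF that] that by auto
      then show ?thesis unfolding cov_vars_def by blast
    qed
    then show ?thesis by (auto simp: keys_sum_nat)
  qed
  ultimately have "Poly_Mapping.single ?m (1 :: complex) \<in>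
    monom_span {m. mon_deg m = k \<and> Poly_Mapping.keys m \<subseteq> cov_vars S T}"
    by (simp add: monom_span_def)
  then show "signof p * Poly_Mapping.single ?m 1 \<in>
    monom_span {m. mon_deg m = k \<and> Poly_Mapping.keys m \<subseteq> cov_vars S T}"
    using monom_span_uminus by (cases "sign p = (1 :: int)") (auto simp: sign_def)
qed

section \<open>Ideals generated by minors\<close>

lemma cov_submat_minors_carrier:
  assumes "S \<subseteq> {1..n}" "T \<subseteq> {1..n}"
  shows "minors k (cov_submat n S T) \<subseteq> carrier (cov_ring n)"
proof
  fix p assume "p \<in> minors k (cov_submat n S T)"
  then obtain f g where p: "p = cov_minor k f g" "f ` {..<k} \<subseteq> S" "g ` {..<k} \<subseteq> T"
    using minors_cov_submatE[OF assms] by metis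
  then have "p \<in> monom_span {m. mon_deg m = k \<and> Poly_Mapping.keys m \<subseteq> cov_vars {1..n} {1..n}}"
    using cov_minor_monom_span[of f k "{1..n}" g "{1..n}"] assms by blast
  then show "p \<in> carrier (cov_ring n)"
    by (auto simp: carrier_cov_ring monom_span_def)
qed

lemma ideal_Idl_minors:
  assumes "S \<subseteq> {1..n}" "T \<subseteq> {1..n}"
  shows "ideal (Idl\<^bsub>cov_ring n\<^esub> (minors k (cov_submat n S T))) (cov_ring n)"
    "minors k (cov_submat n S T) \<subseteq> Idl\<^bsub>cov_ring n\<^esub> (minors k (cov_submat n S T))"
  using cov_submat_minors_carrier[OF assms] 
  by (auto intro: ring.genideal_ideal[OF ring_cov_ring] ring.genideal_self[OF ring_cov_ring, THEN subsetD])

lemma minors_subset_ideal_iff: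
  assumes "ideal I (cov_ring n)" "S \<subseteq> {1..n}" "T \<subseteq> {1..n}"
  shows "minors k (cov_submat n S T) \<subseteq> I \<longleftrightarrow>
    (\<forall>f g. inj_on f {..<k} \<and> inj_on g {..<k} \<and> f ` {..<k} \<subseteq> S \<and> g ` {..<k} \<subseteq> T \<longrightarrow> cov_minor k f g \<in> I)"
    (is "?L \<longleftrightarrow> ?R")
proof
  assume ?L then show ?R using cov_minor_in_ideal[OF assms(1) _ assms(2,3)] by blast
next
  assume R: ?R show ?L
  proof
    fix p assume "p \<in> minors k (cov_submat n S T)"
    then obtain f g where "p = cov_minor k f g" "inj_on f {..<k}" "f ` {..<k} \<subseteq> S"
      "inj_on g {..<k}" "g ` {..<k} \<subseteq> T"
      by (rule minors_cov_submatE[OF assms(2,3)])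
    with R show "p \<in> I" by blast
  qed
qed

lemma ci_ideal_commute:
  assumes "A \<subseteq> {1..n}" "B \<subseteq> {1..n}" "C \<subseteq> {1..n}"
  shows "ci_ideal n A B C = ci_ideal n B A C"
proof -
  have "ci_ideal n A B C \<subseteq> ci_ideal n B A C" if "A \<subseteq> {1..n}" "B \<subseteq> {1..n}" for A B
  proof -
    have sub: "A \<union> C \<subseteq> {1..n}" "B \<union> C \<subseteq> {1..n}" using that assms(3) by auto
    note BA = ideal_Idl_minors[OF sub(2,1), of "card C + 1"]
    have "minors (card C + 1) (cov_submat n (A \<union> C) (B \<union> C))
        \<subseteq> Idl\<^bsub>cov_ring n\<^esub> (minors (card C + 1) (cov_submat n (B \<union> C) (A \<union> C)))"
      using BA(2) unfolding minors_subset_ideal_iff[OF BA(1) sub] minors_subset_ideal_iff[OF BA(1) sub(2,1)]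
      by (subst cov_minor_commute) blast
    then show ?thesis
      unfolding ci_ideal_def by (subst Idl_subset_iff[OF BA(1) cov_submat_minors_carrier[OF sub]])
  qed
  then show ?thesis using assms by blast
qed

section \<open>Indeterminates that occur in minors\<close>

text \<open>
  Since \<open>\<sigma> i j = \<sigma> j i\<close>, the monomial \<open>\<Prod>s\<in>S. \<sigma> s (\<phi> s)\<close> of a bijection \<open>\<phi>\<close> may occur several times in
  the Leibniz expansion of the minor with rows \<open>S\<close> and columns \<open>T\<close>.  It occurs only once if \<open>\<phi>\<close> is an
  involution wherever applying it twice makes sense.  Such a \<open>\<phi>\<close> exists with any prescribed value
  \<open>\<phi> x = y\<close>: it fixes the common indices, apart from \<open>x\<close> and \<open>y\<close>, and it sends \<open>y\<close> back to \<open>x\<close> if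
  \<open>y\<close> is a row and \<open>x\<close> a column.
\<close>

lemma involutive_bij_exists:
  assumes fin: "finite S" "finite T" and card: "card S = card T" and x: "x \<in> S" and y: "y \<in> T"
  obtains \<phi> where "bij_betw \<phi> S T" "\<phi> x = y" "\<And>s. s \<in> S \<Longrightarrow> \<phi> s \<in> S \<Longrightarrow> s \<in> T \<Longrightarrow> \<phi> (\<phi> s) = s"
proof -
  define S' T' where "S' = S - {x}" and "T' = T - {y}"
  define swap where "swap = (y \<in> S' \<and> x \<in> T')"
  define Q where "Q = S' \<inter> T'"
  define D where "D = {x} \<union> Q \<union> (if swap then {y} else {})"
  define E where "E = {y} \<union> Q \<union> (if swap then {x} else {})"
  define \<psi> where "\<psi> s = (if s = x then y else if s = y then x else s)" for s
  have DS: "D \<subseteq> S" and ET: "E \<subseteq> T" using x y by (auto simp: D_def E_def Q_def S'_def T'_def swap_def)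
  have bij1: "bij_betw \<psi> D E"
    unfolding bij_betw_def inj_on_def
    by (auto simp: D_def E_def Q_def S'_def T'_def swap_def \<psi>_def image_iff)
  then have "card D = card E" by (rule bij_betw_same_card)
  then have "card (S - D) = card (T - E)"
    using DS ET fin card by (simp add: card_Diff_subset finite_subset)
  then obtain h where h: "bij_betw h (S - D) (T - E)"
    using finite_same_card_bij fin by blast
  define \<phi> where "\<phi> s = (if s \<in> D then \<psi> s else h s)" for s
  have "bij_betw \<phi> D E"
    using bij1 by (subst bij_betw_cong[of _ _ \<psi>]) (auto simp: \<phi>_def)
  moreover have "bij_betw \<phi> (S - D) (T - E)"
    using h by (subst bij_betw_cong[of _ _ h]) (auto simp: \<phi>_def)
  ultimately have "bij_betw \<phi> (D \<union> (S - D)) (E \<union> (T - E))"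
    by (rule bij_betw_combine) auto
  moreover have "D \<union> (S - D) = S" "E \<union> (T - E) = T" using DS ET by auto
  ultimately have "bij_betw \<phi> S T" by simp
  moreover have "\<phi> x = y" by (simp add: \<phi>_def D_def \<psi>_def)
  moreover have "\<phi> (\<phi> s) = s" if s: "s \<in> S" "\<phi> s \<in> S" "s \<in> T" for s
  proof (cases "s \<in> D")
    case True
    show ?thesis
    proof (cases "s = x")
      case True
      with s y show ?thesis
        by (cases "x = y") (auto simp: \<phi>_def D_def \<psi>_def swap_def S'_def T'_def)
    next
      case False
      with True s show ?thesis
        by (auto simp: \<phi>_def D_def \<psi>_def swap_def S'_def T'_def Q_def)
    qed
  next
    case False
    \<comment> \<open>Outside \<open>D\<close> only \<open>s = y\<close> is a column, and its image can be a row only if it is \<open>x\<close>.\<close>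
    then have "s = y" "\<not> swap" using s by (auto simp: D_def Q_def S'_def T'_def)
    have "\<phi> s \<in> T - E" using h False s by (auto simp: \<phi>_def bij_betw_def)
    then have "\<phi> s = x" using s by (auto simp: E_def Q_def S'_def T'_def)
    then have "swap" using \<open>s = y\<close> False \<open>\<phi> s \<in> T - E\<close> s x by (auto simp: swap_def S'_def T'_def D_def E_def)
    with \<open>\<not> swap\<close> show ?thesis by simp
  qed
  ultimately show ?thesis using that by blast
qed

text \<open>
  With the rows listed by \<open>f\<close> and the columns by \<open>\<phi> \<circ> f\<close>, the monomial of \<open>\<phi>\<close> is the product of the
  diagonal.  Only the identity permutation contributes to it, so its coefficient is \<open>1\<close>.
\<close>

lemma cov_minor_key:
  assumes "bij_betw \<phi> S T" "\<And>s. s \<in> S \<Longrightarrow> \<phi> s \<in> S \<Longrightarrow> s \<in> T \<Longrightarrow> \<phi> (\<phi> s) = s"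
    "bij_betw f {0..<k} S"
  shows "(\<Sum>a = 0..<k. Poly_Mapping.single (Upair (f a) (\<phi> (f a))) 1) \<in> Poly_Mapping.keys (cov_minor k f (\<phi> \<circ> f))"
proof -
  define mon :: "(nat \<Rightarrow> nat) \<Rightarrow> nat uprod \<Rightarrow>\<^sub>0 nat" where
    "mon p = (\<Sum>a = 0..<k. Poly_Mapping.single (Upair (f a) (\<phi> (f (p a)))) 1)" for p
  have uniq: "p = id" if p: "p permutes {0..<k}" and eq: "mon p = mon id" for p
  proof
    fix a
    show "p a = id a"
    proof (cases "a < k")
      case False
      then show ?thesis using permutes_not_in[OF p, of a] by simp
    next
      case True
      then have pa: "p a < k" using permutes_in_image[OF p, of a] by simp
      have "Upair (f a) (\<phi> (f (p a))) \<in> Poly_Mapping.keys (mon p)"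
        unfolding mon_def using True by (auto simp: keys_sum_nat)
      then have "Upair (f a) (\<phi> (f (p a))) \<in> Poly_Mapping.keys (mon id)" using eq by simp
      then obtain b where b: "b < k" "Upair (f a) (\<phi> (f (p a))) = Upair (f b) (\<phi> (f b))"
        unfolding mon_def by (auto simp: keys_sum_nat simp del: Upair_inject)
      have S: "f a \<in> S" "f b \<in> S" "f (p a) \<in> S"
        using True b(1) pa assms(3) by (auto simp: bij_betw_def)
      have inj: "inj_on (\<phi> \<circ> f) {0..<k}" "inj_on f {0..<k}" 
        using bij_betw_trans[OF assms(3,1)] assms(3) by (auto simp: bij_betw_def)
      from b(2) consider "f a = f b" "\<phi> (f (p a)) = \<phi> (f b)" | "f a = \<phi> (f b)" "\<phi> (f (p a)) = f b"
        by auto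
      then show ?thesis
      proof cases
        case 1
        then have "a = b" "p a = b"
          using inj True b(1) pa by (auto simp: inj_on_def)
        then show ?thesis by simp
      next
        case 2
        \<comment> \<open>The two positions are mirror images, so \<open>\<phi>\<close> leads from the column of one back to its row.\<close>
        then have "f b \<in> T" using S assms(1) by (metis bij_betwE)
        with assms(2)[of "f b"] 2 S have "\<phi> (f a) = f b" by simp
        with 2 have "\<phi> (f (p a)) = \<phi> (f a)" by simp
        then show ?thesis using inj True pa by (auto simp: inj_on_def)
      qed
    qed
  qed
  have look: "Poly_Mapping.lookup (signof p * Poly_Mapping.single m (1 :: complex)) m' =
      signof p * (if m = m' then 1 else 0)" for p :: "nat \<Rightarrow> nat" and m m' :: "nat uprod \<Rightarrow>\<^sub>0 nat"
    by (cases "sign p = (1 :: int)") (auto simp: sign_def lookup_single)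
  have "Poly_Mapping.lookup (cov_minor k f (\<phi> \<circ> f)) (mon id) =
    (\<Sum>p | p permutes {0..<k}. signof p * (if mon p = mon id then 1 else 0))"
    unfolding cov_minor_eq_sum lookup_sum mon_def comp_def look by simp
  also have "\<dots> = (\<Sum>p | p permutes {0..<k}. if p = id then 1 else 0)"
    using uniq by (intro sum.cong) auto
  also have "\<dots> = 1"
    using finite_permutations[of "{0..<k}"] by (simp add: permutes_id)
  finally show ?thesis by (simp add: in_keys_iff mon_def)
qed

text \<open>
  Every entry of \<open>\<Sigma>\<^bsub>S,T\<^esub>\<close> occurs in some \<open>k\<close>-minor, whenever \<open>k > 0\<close> and there are
  \<open>k\<close>-minors at all; the monomial that contains it has degree \<open>k\<close>.
\<close>

lemma minor_with_var:
  assumes "S \<subseteq> {1..n}" "T \<subseteq> {1..n}" "x \<in> S" "y \<in> T" "0 < k" "k \<le> card S" "k \<le> card T"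
    "ideal I (cov_ring n)" "minors k (cov_submat n S T) \<subseteq> I"
  obtains p m where "p \<in> I" "m \<in> Poly_Mapping.keys p" "mon_deg m = k" "Upair x y \<in> Poly_Mapping.keys m"
proof -
  have fin: "finite S" "finite T" using assms(1,2) finite_subset by blast+
  have choose: "\<exists>U. U \<subseteq> S \<and> x \<in> U \<and> card U = k" if "finite S" "x \<in> S" "k \<le> card S" for S :: "nat set" and x
  proof -
    have "k - 1 \<le> card (S - {x})" using that assms(5) by (simp add: card_Diff_singleton)
    then obtain V where "V \<subseteq> S - {x}" "card V = k - 1"
      by (meson obtain_subset_with_card_n)
    moreover from this have "finite V" using that finite_subset by blast
    ultimately show ?thesis using that assms(5)
      by (intro exI[of _ "insert x V"]) (auto simp: card_insert_if)
  qed
  obtain U V where U: "U \<subseteq> S" "x \<in> U" "card U = k" and V: "V \<subseteq> T" "y \<in> V" "card V = k"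
    using choose[OF fin(1)] choose[OF fin(2)] assms by meson
  have finUV: "finite U" "finite V" using U V fin finite_subset by blast+
  have cUV: "card U = card V" using U V by simp
  obtain \<phi> where \<phi>: "bij_betw \<phi> U V" "\<phi> x = y" "\<And>s. s \<in> U \<Longrightarrow> \<phi> s \<in> U \<Longrightarrow> s \<in> V \<Longrightarrow> \<phi> (\<phi> s) = s"
    by (rule involutive_bij_exists[OF finUV cUV U(2) V(2)]) blast
  obtain f where f: "bij_betw f {0..<k} U"
    using ex_bij_betw_nat_finite[OF finUV(1)] U by auto
  let ?m = "\<Sum>a = 0..<k. Poly_Mapping.single (Upair (f a) (\<phi> (f a))) 1 :: nat uprod \<Rightarrow>\<^sub>0 nat"
  have "?m \<in> Poly_Mapping.keys (cov_minor k f (\<phi> \<circ> f))"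
    by (rule cov_minor_key[OF \<phi>(1,3) f])
  moreover have "cov_minor k f (\<phi> \<circ> f) \<in> I"
  proof (rule cov_minor_in_ideal[OF assms(8,9,1,2)])
    show "f ` {..<k} \<subseteq> S" using f U by (auto simp: bij_betw_def atLeast0LessThan)
    show "(\<phi> \<circ> f) ` {..<k} \<subseteq> T" 
      using bij_betw_trans[OF f \<phi>(1)] V by (auto simp: bij_betw_def atLeast0LessThan)
  qed
  moreover have "mon_deg ?m = k" by (simp add: mon_deg_sum)
  moreover have "Upair x y \<in> Poly_Mapping.keys ?m"
  proof -
    obtain a where "a < k" "f a = x" using f U(2) by (auto simp: bij_betw_def)
    then show ?thesis using \<phi>(2) by (auto simp: keys_sum_nat)
  qed
  ultimately show ?thesis using that by blast
qed

section \<open>Minors forced by a rank condition on one block\<close>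

lemma cov_var_carrier: "i \<in> {1..n} \<Longrightarrow> j \<in> {1..n} \<Longrightarrow> \<sigma> i j \<in> carrier (cov_ring n)"
  unfolding carrier_cov_ring monom_span_def cov_var_def cov_vars_def by auto

lemma cov_minor_expand_in_ideal:
  assumes I: "ideal I (cov_ring n)" and fg: "f ` {..<Suc k} \<subseteq> {1..n}" "g ` {..<Suc k} \<subseteq> {1..n}"
    and a: "a < Suc k"
    and sub: "\<And>b. b < Suc k \<Longrightarrow> cov_minor k (f \<circ> skip a) (g \<circ> skip b) \<in> I"
  shows "cov_minor (Suc k) f g \<in> I"
  unfolding cov_minor_expand_row[OF a]
proof (rule cov_ideal_sum[OF I])
  fix b assume b: "b \<in> {..<Suc k}"
  let ?x = "cov_minor k (f \<circ> skip a) (g \<circ> skip b)"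
  have "(- 1) ^ (a + b) * ?x \<in> I"
    using sub[of b] b cov_ideal_closed(3)[OF I] by (cases "even (a + b)") auto
  moreover have "\<sigma> (f a) (g b) \<in> carrier (cov_ring n)"
    using fg a b by (intro cov_var_carrier) auto
  ultimately show "\<sigma> (f a) (g b) * ((- 1) ^ (a + b) * ?x) \<in> I"
    by (rule cov_ideal_closed(4)[OF I])
qed

lemma card_skip:
  "card {b. b < k \<and> P (skip a b)} \<le> card ({b. b < Suc k \<and> P b} - {a})"
proof (rule card_inj_on_le)
  show "inj_on (skip a) {b. b < k \<and> P (skip a b)}"
    by (auto simp: skip_def inj_on_def split: if_splits)
  show "skip a ` {b. b < k \<and> P (skip a b)} \<subseteq> {b. b < Suc k \<and> P b} - {a}"
  proof
    fix x assume "x \<in> skip a ` {b. b < k \<and> P (skip a b)}"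
    then obtain b where "x = skip a b" "b < k" "P (skip a b)" by blast
    then show "x \<in> {b. b < Suc k \<and> P b} - {a}" by (simp add: skip_def)
  qed
qed simp

text \<open>
  If the block \<open>\<Sigma>\<^bsub>S,T\<^esub>\<close> has rank at most \<open>c\<close>, then adding \<open>s\<close> rows and \<open>t\<close> columns gives rank at most
  \<open>c + s + t\<close>.  In terms of ideals: expand along the added rows and columns, one at a time, until
  only minors of the block remain, and expand those down to size \<open>c + 1\<close>.
\<close>

lemma cov_minor_block_in_ideal:
  assumes I: "ideal I (cov_ring n)" "minors (c + 1) (cov_submat n S T) \<subseteq> I"
    and ST: "S \<subseteq> {1..n}" "T \<subseteq> {1..n}"
  shows "f ` {..<k} \<subseteq> {1..n} \<Longrightarrow> g ` {..<k} \<subseteq> {1..n} \<Longrightarrow>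
    card {a. a < k \<and> f a \<notin> S} + card {b. b < k \<and> g b \<notin> T} + c < k \<Longrightarrow> cov_minor k f g \<in> I"
proof (induction k arbitrary: f g)
  case 0
  then show ?case by simp
next
  case (Suc k)
  have skip: "(h \<circ> skip a) ` {..<k} \<subseteq> {1..n}" if "h ` {..<Suc k} \<subseteq> {1..n}" for h a
    using that by (auto simp: skip_def image_subset_iff)
  have less: "card {b. b < k \<and> (h \<circ> skip a) b \<notin> U} < card {b. b < Suc k \<and> h b \<notin> U}"
    if "a < Suc k" "h a \<notin> U" for h a and U :: "nat set"
  proof -
    have "card ({b. b < Suc k \<and> h b \<notin> U} - {a}) < card {b. b < Suc k \<and> h b \<notin> U}"
      using that by (intro psubset_card_mono) auto
    then show ?thesis using card_skip[of k "\<lambda>b. h b \<notin> U" a] by simp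
  qed
  have le: "card {b. b < k \<and> (h \<circ> skip a) b \<notin> U} \<le> card {b. b < Suc k \<and> h b \<notin> U}" for h a and U :: "nat set"
    using card_skip[of k "\<lambda>b. h b \<notin> U" a] card_mono[of "{b. b < Suc k \<and> h b \<notin> U}" "{b. b < Suc k \<and> h b \<notin> U} - {a}"]
    by simp
  consider (row) a where "a < Suc k" "f a \<notin> S" | (col) b where "b < Suc k" "g b \<notin> T"
    | (gen) "f ` {..<Suc k} \<subseteq> S" "g ` {..<Suc k} \<subseteq> T" "k = c"
    | (big) "f ` {..<Suc k} \<subseteq> S" "g ` {..<Suc k} \<subseteq> T" "c < k"
    using Suc.prems(3) by (cases "k = c") (auto simp: image_subset_iff)
  then show ?case
  proof cases
    case row
    show ?thesis
    proof (rule cov_minor_expand_in_ideal[OF I(1) Suc.prems(1,2) row(1)])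
      fix b assume "b < Suc k"
      show "cov_minor k (f \<circ> skip a) (g \<circ> skip b) \<in> I"
        using less[of a f S, OF row] le[of g b T] Suc.prems by (intro Suc.IH skip) simp_all
    qed
  next
    case col
    show ?thesis
      unfolding cov_minor_commute[of _ f]
    proof (rule cov_minor_expand_in_ideal[OF I(1) Suc.prems(2,1) col(1)])
      fix a assume "a < Suc k"
      show "cov_minor k (g \<circ> skip b) (f \<circ> skip a) \<in> I"
        unfolding cov_minor_commute[of _ "g \<circ> _"]
        using less[of b g T, OF col] le[of f a S] Suc.prems by (intro Suc.IH skip) simp_all
    qed
  next
    case gen
    then show ?thesis using cov_minor_in_ideal[OF I(1) _ ST] I(2) by simp
  next
    case big
    show ?thesis
    proof (rule cov_minor_expand_in_ideal[OF I(1) Suc.prems(1,2), of 0])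
      fix b assume "b < Suc k"
      have "(f \<circ> skip 0) ` {..<k} \<subseteq> S" "(g \<circ> skip b) ` {..<k} \<subseteq> T"
        using big by (auto simp: skip_def image_subset_iff)
      then have "{a. a < k \<and> (f \<circ> skip 0) a \<notin> S} = {}" "{a. a < k \<and> (g \<circ> skip b) a \<notin> T} = {}"
        by (auto simp: image_subset_iff)
      then show "cov_minor k (f \<circ> skip 0) (g \<circ> skip b) \<in> I"
        using big(3) by (intro Suc.IH skip Suc.prems) (simp only: card.empty)
    qed simp
  qed
qed

section \<open>The permutation of a single rank condition\<close>

lemma schubert_rank_eq_card:
  assumes "w permutes {1..n}" "i \<le> n" "j \<in> {1..n}"
  shows "schubert_rank n w i j = card {k \<in> {1..i}. w k \<le> n + 1 - j}"
proof -
  have "(\<Sum>l = j..n. schubert_perm_mat n w k l) = (if w k \<le> n + 1 - j then 1 else 0)" if "k \<in> {1..i}" for k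
  proof -
    have "w k \<in> {1..n}" using that assms permutes_in_image[OF assms(1), of k] by auto
    then show ?thesis using assms(3) by (auto simp: schubert_perm_mat_def)
  qed
  then show ?thesis by (simp add: schubert_rank_def sum.If_cases Int_def)
qed

text \<open>
  The permutation that exchanges the adjacent blocks \<open>[c+1, p]\<close> and \<open>[p+1, p+r]\<close>, of lengths
  \<open>p - c\<close> and \<open>r\<close>, each in its own order.  Its matrix \<open>schubert_perm_mat\<close> has \<open>c\<close> ones in the
  first \<open>p\<close> rows and the last \<open>c + r\<close> columns, and as many ones as this allows in every other upper
  right corner.
\<close>

definition block_swap :: "nat \<Rightarrow> nat \<Rightarrow> nat \<Rightarrow> nat \<Rightarrow> nat" where
  "block_swap c p r k =
     (if k \<in> {c + 1..p} then k + r else if k \<in> {p + 1..p + r} then k - (p - c) else k)"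

lemma block_swap_permutes:
  assumes "c \<le> p" "p + r \<le> n"
  shows "block_swap c p r permutes {1..n}"
proof (rule bij_imp_permutes)
  have "inj_on (block_swap c p r) {1..n}"
    using assms by (auto simp: inj_on_def block_swap_def split: if_splits)
  moreover have "block_swap c p r ` {1..n} \<subseteq> {1..n}"
    using assms by (auto simp: block_swap_def split: if_splits)
  ultimately show "bij_betw (block_swap c p r) {1..n} {1..n}"
    by (simp add: bij_betw_def endo_inj_surj)
qed (use assms in \<open>auto simp: block_swap_def\<close>)

text \<open>
  Here \<open>b\<close> is the number of columns of an upper right corner with \<open>a\<close> rows.  The four intervals in
  the proof are the parts of the four pieces of \<open>block_swap\<close> that contribute to the corner.
\<close>

lemma block_swap_rank_ge:
  assumes "c \<le> p"
  shows "min a (min b (c + (a - p) + (b - (c + r)))) \<le> card {k \<in> {1..a}. block_swap c p r k \<le> b}"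
proof -
  define X1 X2 X3 X4 where "X1 = {1..min a (min b c)}" and "X2 = {c + 1..min (min a p) (b - r)}"
    and "X3 = {p + 1..min (min a (p + r)) (b + (p - c))}" and "X4 = {p + r + 1..min a b}"
  have sub: "X1 \<union> (X2 \<union> (X3 \<union> X4)) \<subseteq> {k \<in> {1..a}. block_swap c p r k \<le> b}"
    using assms by (auto simp: X1_def X2_def X3_def X4_def block_swap_def)
  have "card (X1 \<union> (X2 \<union> (X3 \<union> X4))) = card X1 + (card X2 + (card X3 + card X4))"
    using assms by (subst card_Un_disjoint; (subst card_Un_disjoint; (subst card_Un_disjoint)?)?)
      (auto simp: X1_def X2_def X3_def X4_def)
  moreover have "min a (min b (c + (a - p) + (b - (c + r)))) \<le> card X1 + (card X2 + (card X3 + card X4))"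
  proof -
    obtain d where d: "p = c + d" using assms le_Suc_ex by blast
    have X: "card X1 = min a (min b c)" "card X2 = min (min a p) (b - r) - c"
      "card X3 = min (min a (p + r)) (b + d) - p" "card X4 = min a b - (p + r)"
      by (simp_all add: X1_def X2_def X3_def X4_def d)
    show ?thesis
      unfolding X unfolding d
      by (cases "b \<le> c"; cases "b \<le> c + r"; cases "a \<le> c"; cases "a \<le> c + d"; cases "a \<le> c + d + r") (auto simp: min_def)
  qed
  ultimately show ?thesis
    using card_mono[OF _ sub] by simp
qed

lemma block_swap_rank_corner:
  assumes "c \<le> p"
  shows "card {k \<in> {1..p}. block_swap c p r k \<le> c + r} = c"
proof -
  have "{k \<in> {1..p}. block_swap c p r k \<le> c + r} = {1..c}"
    using assms by (auto simp: block_swap_def split: if_splits)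
  then show ?thesis by simp
qed

lemma Idl_minors_subset_sym_schubert_ideal:
  assumes "i \<in> {1..n}" "j \<in> {1..n}"
  shows "Idl\<^bsub>cov_ring n\<^esub> (minors (schubert_rank n w i j + 1) (cov_submat n {1..i} {j..n}))
    \<subseteq> sym_schubert_ideal n w"
proof -
  let ?F = "\<lambda>i j. Idl\<^bsub>cov_ring n\<^esub> (minors (schubert_rank n w i j + 1) (cov_submat n {1..i} {j..n}))"
  have zero: "0 \<in> ?F i j" if "i \<in> {1..n}" "j \<in> {1..n}" for i j
    using that by (intro cov_ideal_closed(1)[OF ideal_Idl_minors(1)]) auto
  have row: "?F i j \<subseteq> (\<Sum>j = 1..n. ?F i j)" if "i \<in> {1..n}" "j \<in> {1..n}" for i j
    using that zero by (intro subset_sum_sets) auto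
  have "(\<Sum>j = 1..n. ?F i j) \<subseteq> sym_schubert_ideal n w"
    unfolding sym_schubert_ideal_def
  proof (rule subset_sum_sets)
    fix b assume b: "b \<in> {1..n}"
    then show "0 \<in> (\<Sum>j = 1..n. ?F b j)" using row[OF b assms(2)] zero[OF b assms(2)] by blast
  qed (use assms in auto)
  with row[OF assms] show ?thesis by blast
qed

lemma sym_schubert_ideal_subsetI:
  assumes "ideal I (cov_ring n)"
    and "\<And>i j. i \<in> {1..n} \<Longrightarrow> j \<in> {1..n} \<Longrightarrow>
      minors (schubert_rank n w i j + 1) (cov_submat n {1..i} {j..n}) \<subseteq> I"
  shows "sym_schubert_ideal n w \<subseteq> I"
proof -
  have "Idl\<^bsub>cov_ring n\<^esub> (minors (schubert_rank n w i j + 1) (cov_submat n {1..i} {j..n})) \<subseteq> I"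
    if "i \<in> {1..n}" "j \<in> {1..n}" for i j
    using ring.genideal_minimal[OF ring_cov_ring assms(1) assms(2)[OF that]] .
  then show ?thesis
    unfolding sym_schubert_ideal_def by (intro sum_ideals_subset[OF assms(1)]) blast
qed

text \<open>
  The rank condition \<open>\<le> c\<close> on the corner \<open>[1, p] \<times> [q, n]\<close> is Schubert if \<open>p + 1 \<le> c + q\<close>.  This
  inequality says that the permutation of the condition fits into \<open>{1..n}\<close>: with \<open>n + 1 - q = c + r\<close>
  it reads \<open>p + r \<le> n\<close>.
\<close>

lemma block_ideal_is_sym_schubert_ideal:
  assumes p: "p \<in> {1..n}" and q: "q \<in> {1..n}" and c: "c \<le> p" "c + q \<le> n + 1" "p + 1 \<le> c + q"
  shows "is_sym_schubert_ideal n (Idl\<^bsub>cov_ring n\<^esub> (minors (c + 1) (cov_submat n {1..p} {q..n})))"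
    (is "is_sym_schubert_ideal n ?J")
proof -
  define r where "r = n + 1 - q - c"
  define w where "w = block_swap c p r"
  have w: "w permutes {1..n}"
    unfolding w_def using c by (intro block_swap_permutes) (auto simp: r_def)
  have sub: "{1..p} \<subseteq> {1..n}" "{q..n} \<subseteq> {1..n}" using p q by auto
  note J = ideal_Idl_minors[OF sub, of "c + 1"]
  have rpq: "schubert_rank n w p q = c"
  proof -
    have "c + r = n + 1 - q" using c by (simp add: r_def)
    then show ?thesis
      using schubert_rank_eq_card[OF w _ q] p block_swap_rank_corner[OF c(1), of r] by (simp add: w_def)
  qed
  have "sym_schubert_ideal n w \<subseteq> ?J"
  proof (rule sym_schubert_ideal_subsetI[OF J(1)])
    fix i j assume ij: "i \<in> {1..n}" "j \<in> {1..n}"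
    define k where "k = schubert_rank n w i j + 1"
    have sub': "{1..i} \<subseteq> {1..n}" "{j..n} \<subseteq> {1..n}" using ij by auto
    have k: "min i (min (n + 1 - j) (c + (i - p) + (q - j))) < k"
    proof -
      have "(n + 1 - j) - (c + r) = q - j" using c q ij by (auto simp: r_def)
      moreover have "k = card {k \<in> {1..i}. block_swap c p r k \<le> n + 1 - j} + 1"
        unfolding k_def using schubert_rank_eq_card[OF w, of i j] ij by (simp add: w_def)
      ultimately show ?thesis
        using block_swap_rank_ge[OF c(1), of i "n + 1 - j" r] by (simp only: less_Suc_eq_le Suc_eq_plus1[symmetric])
    qed
    have "minors k (cov_submat n {1..i} {j..n}) \<subseteq> ?J"
      unfolding minors_subset_ideal_iff[OF J(1) sub']
    proof (intro allI impI, elim conjE)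
      fix f g assume f: "inj_on f {..<k}" "f ` {..<k} \<subseteq> {1..i}"
        and g: "inj_on g {..<k}" "g ` {..<k} \<subseteq> {j..n}"
      \<comment> \<open>The first two terms of the minimum would leave no room for \<open>k\<close> distinct rows or columns.\<close>
      have "card {..<k} \<le> card {1..i}" "card {..<k} \<le> card {j..n}"
        by (rule card_inj_on_le[OF f], simp, rule card_inj_on_le[OF g], simp)
      then have "c + (i - p) + (q - j) < k" using k by (simp add: min_less_iff_disj)
      moreover have "card {a. a < k \<and> f a \<notin> {1..p}} \<le> card {p + 1..i}"
        by (rule card_inj_on_le[of f]) (use f in \<open>auto simp: inj_on_def image_subset_iff\<close>)
      moreover have "card {b. b < k \<and> g b \<notin> {q..n}} \<le> card {j..<q}"
        by (rule card_inj_on_le[of g]) (use g in \<open>auto simp: inj_on_def image_subset_iff\<close>)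
      ultimately have "card {a. a < k \<and> f a \<notin> {1..p}} + card {b. b < k \<and> g b \<notin> {q..n}} + c < k"
        by simp
      then show "cov_minor k f g \<in> ?J"
        using f g sub' by (intro cov_minor_block_in_ideal[OF J sub]) auto
    qed
    then show "minors (schubert_rank n w i j + 1) (cov_submat n {1..i} {j..n}) \<subseteq> ?J"
      by (simp only: k_def)
  qed
  moreover have "?J \<subseteq> sym_schubert_ideal n w"
    using Idl_minors_subset_sym_schubert_ideal[OF p q, of w] by (simp only: rpq)
  ultimately show ?thesis
    unfolding is_sym_schubert_ideal_def using w by blast
qed

lemma interval_ci_is_sym_schubert_ideal:
  assumes "interval_ci n A B C"
  shows "is_sym_schubert_ideal n (ci_ideal n A B C)"
  using assms unfolding interval_ci_def
proof (elim disjE bexE conjE)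
  fix i j assume *: "i \<in> {1..n}" "j \<in> {1..n}" "i < j" "A = {1..i}" "B = {j..n}" "C = {}"
  then have "is_sym_schubert_ideal n (Idl\<^bsub>cov_ring n\<^esub> (minors (0 + 1) (cov_submat n {1..i} {j..n})))"
    by (intro block_ideal_is_sym_schubert_ideal) auto
  then show ?thesis by (simp add: ci_ideal_def *)
next
  fix i j assume *: "i \<in> {1..n}" "j \<in> {1..n}" "i < j - 1" "A = {1..i}" "B = {j..n}" "C = {i + 1..j - 1}"
  then have "A \<union> C = {1..j - 1}" "B \<union> C = {i + 1..n}" "card C = j - 1 - i" by auto
  moreover have "is_sym_schubert_ideal n
      (Idl\<^bsub>cov_ring n\<^esub> (minors ((j - 1 - i) + 1) (cov_submat n {1..j - 1} {i + 1..n})))"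
    using * by (intro block_ideal_is_sym_schubert_ideal) auto
  ultimately show ?thesis by (simp add: ci_ideal_def)
qed

section \<open>Indeterminates in the lowest degree\<close>

text \<open>The indeterminates that occur in degree \<open>d\<close> in some element of \<open>I\<close>.\<close>

definition vars_in_degree :: "nat \<Rightarrow> cov_poly set \<Rightarrow> nat uprod set" where
  "vars_in_degree d I = {u. \<exists>p \<in> I. \<exists>m \<in> Poly_Mapping.keys p. mon_deg m = d \<and> u \<in> Poly_Mapping.keys m}"

text \<open>
  The polynomials of \<open>\<complex>[\<Sigma>]\<close> without terms of degree less than \<open>d\<close> and whose terms of degree \<open>d\<close>
  contain only indeterminates from \<open>V\<close>.  They form an ideal: in a multiple \<open>r * p\<close> of such a
  polynomial \<open>p\<close>, terms of degree \<open>d\<close> arise only from the constant term of \<open>r\<close>.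
\<close>

definition low_degree_ideal :: "nat \<Rightarrow> nat \<Rightarrow> nat uprod set \<Rightarrow> cov_poly set" where
  "low_degree_ideal n d V = carrier (cov_ring n) \<inter>
     monom_span {m. d \<le> mon_deg m \<and> (mon_deg m = d \<longrightarrow> Poly_Mapping.keys m \<subseteq> V)}"

lemma ideal_low_degree_ideal: "ideal (low_degree_ideal n d V) (cov_ring n)"
proof (rule cov_idealI)
  fix p r assume p: "p \<in> low_degree_ideal n d V" and r: "r \<in> carrier (cov_ring n)"
  let ?P = "{m. d \<le> mon_deg m \<and> (mon_deg m = d \<longrightarrow> Poly_Mapping.keys m \<subseteq> V)}"
  have "r * p \<in> monom_span ?P"
  proof (rule monom_span_mult)
    show "r \<in> monom_span UNIV" by (simp add: monom_span_def)
    show "p \<in> monom_span ?P" using p by (simp add: low_degree_ideal_def)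
    fix a b assume b: "b \<in> ?P"
    show "a + b \<in> ?P"
    proof (cases "mon_deg a = 0")
      case True
      with b show ?thesis by (simp add: mon_deg_eq_0_iff)
    next
      case False
      with b show ?thesis by (auto simp: mon_deg_add)
    qed
  qed
  then show "r * p \<in> low_degree_ideal n d V"
    using p r cov_ring_closed by (simp add: low_degree_ideal_def)
qed (auto simp: low_degree_ideal_def cov_ring_closed monom_span_zero monom_span_add monom_span_uminus)

lemma vars_in_degree_subset: "I \<subseteq> low_degree_ideal n d V \<Longrightarrow> vars_in_degree d I \<subseteq> V"
  by (fastforce simp: low_degree_ideal_def vars_in_degree_def monom_span_def)

lemma minors_subset_low_degree_ideal:
  assumes "S \<subseteq> {1..n}" "T \<subseteq> {1..n}" "d \<le> k" "k = d \<Longrightarrow> cov_vars S T \<subseteq> V"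
  shows "minors k (cov_submat n S T) \<subseteq> low_degree_ideal n d V"
proof
  fix x assume x: "x \<in> minors k (cov_submat n S T)"
  then obtain f g where "x = cov_minor k f g" "f ` {..<k} \<subseteq> S" "g ` {..<k} \<subseteq> T"
    using minors_cov_submatE[OF assms(1,2)] by metis
  then have "x \<in> monom_span {m. mon_deg m = k \<and> Poly_Mapping.keys m \<subseteq> cov_vars S T}"
    using cov_minor_monom_span by blast
  then have "x \<in> monom_span {m. d \<le> mon_deg m \<and> (mon_deg m = d \<longrightarrow> Poly_Mapping.keys m \<subseteq> V)}"
    using assms(3,4) unfolding monom_span_def by blast
  then show "x \<in> low_degree_ideal n d V"
    using x cov_submat_minors_carrier[OF assms(1,2)] by (auto simp: low_degree_ideal_def)
qed

lemma ci_ideal_subset_low_degree: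
  assumes "ci_statement n A B C"
  shows "ci_ideal n A B C \<subseteq> low_degree_ideal n (card C + 1) (cov_vars (A \<union> C) (B \<union> C))"
proof -
  have sub: "A \<union> C \<subseteq> {1..n}" "B \<union> C \<subseteq> {1..n}" using assms by (auto simp: ci_statement_def)
  show ?thesis
    unfolding ci_ideal_def
    by (subst Idl_subset_iff[OF ideal_low_degree_ideal cov_submat_minors_carrier[OF sub]])
      (rule minors_subset_low_degree_ideal[OF sub]; simp)
qed

lemma vars_in_degree_ci_ideal:
  assumes "ci_statement n A B C"
  shows "vars_in_degree (card C + 1) (ci_ideal n A B C) = cov_vars (A \<union> C) (B \<union> C)"
proof
  show "vars_in_degree (card C + 1) (ci_ideal n A B C) \<subseteq> cov_vars (A \<union> C) (B \<union> C)"
    using vars_in_degree_subset[OF ci_ideal_subset_low_degree[OF assms]] .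
  have sub: "A \<union> C \<subseteq> {1..n}" "B \<union> C \<subseteq> {1..n}" using assms by (auto simp: ci_statement_def)
  have card: "card C + 1 \<le> card (X \<union> C)" if "X \<inter> C = {}" "X \<noteq> {}" "X \<subseteq> {1..n}" for X
  proof -
    have "finite X" "finite C" using that(3) sub finite_subset by blast+
    with that show ?thesis by (simp add: card_Un_disjoint Suc_leI card_gt_0_iff)
  qed
  note J = ideal_Idl_minors[OF sub, of "card C + 1"]
  show "cov_vars (A \<union> C) (B \<union> C) \<subseteq> vars_in_degree (card C + 1) (ci_ideal n A B C)"
  proof
    fix u assume "u \<in> cov_vars (A \<union> C) (B \<union> C)"
    then obtain x y where u: "u = Upair x y" "x \<in> A \<union> C" "y \<in> B \<union> C" by (auto simp: cov_vars_def)
    have "0 < card C + 1" "card C + 1 \<le> card (A \<union> C)" "card C + 1 \<le> card (B \<union> C)"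
      using assms card by (simp_all add: ci_statement_def)
    from minor_with_var[OF sub u(2,3) this J]
    obtain p m where "p \<in> ci_ideal n A B C" "m \<in> Poly_Mapping.keys p" "mon_deg m = card C + 1"
      "Upair x y \<in> Poly_Mapping.keys m"
      unfolding ci_ideal_def by blast
    then show "u \<in> vars_in_degree (card C + 1) (ci_ideal n A B C)"
      unfolding vars_in_degree_def u(1) by blast
  qed
qed

text \<open>
  The corners \<open>[1, i] \<times> [j, n]\<close> on which the rank condition is \<open>\<le> c\<close> and not vacuous; \<open>c + j \<le> n\<close>
  says that there are more than \<open>c\<close> columns.
\<close>

definition rank_corners :: "nat \<Rightarrow> (nat \<Rightarrow> nat) \<Rightarrow> nat \<Rightarrow> (nat \<times> nat) set" where
  "rank_corners n w c = {(i, j). i \<in> {1..n} \<and> j \<in> {1..n} \<and> schubert_rank n w i j = c \<and> c < i \<and> c + j \<le> n}"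

text \<open>
  If the elements of a Schubert ideal have no terms of degree \<open>c\<close> or less, then all conditions of
  rank less than \<open>c\<close> are vacuous, because non-vacuous ones contribute nonzero minors.  So the terms of
  degree \<open>c + 1\<close> come from the corners of rank \<open>c\<close>.
\<close>

lemma vars_in_degree_sym_schubert_ideal:
  assumes low: "sym_schubert_ideal n w \<subseteq> low_degree_ideal n (c + 1) V"
  shows "vars_in_degree (c + 1) (sym_schubert_ideal n w) =
    (\<Union>(i, j) \<in> rank_corners n w c. cov_vars {1..i} {j..n})" (is "_ = ?U")
proof
  have key: "\<exists>p \<in> sym_schubert_ideal n w. \<exists>m \<in> Poly_Mapping.keys p. 
      mon_deg m = schubert_rank n w i j + 1 \<and> Upair x y \<in> Poly_Mapping.keys m"
    if ij: "i \<in> {1..n}" "j \<in> {1..n}" "schubert_rank n w i j < i" "schubert_rank n w i j + j \<le> n"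
      and xy: "x \<in> {1..i}" "y \<in> {j..n}" for i j x y
  proof -
    have sub: "{1..i} \<subseteq> {1..n}" "{j..n} \<subseteq> {1..n}" using ij by auto
    show ?thesis
      by (rule minor_with_var[OF sub xy _ _ _ ideal_Idl_minors[OF sub, of "schubert_rank n w i j + 1"]])
        (use ij Idl_minors_subset_sym_schubert_ideal[OF ij(1,2), of w] in \<open>auto\<close>)
  qed
  show "?U \<subseteq> vars_in_degree (c + 1) (sym_schubert_ideal n w)"
  proof
    fix u assume "u \<in> ?U"
    then obtain i j x y where "(i, j) \<in> rank_corners n w c" "x \<in> {1..i}" "y \<in> {j..n}" "u = Upair x y"
      by (auto simp: cov_vars_def)
    then show "u \<in> vars_in_degree (c + 1) (sym_schubert_ideal n w)"
      using key[of i j x y] by (auto simp: rank_corners_def vars_in_degree_def)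
  qed
  show "vars_in_degree (c + 1) (sym_schubert_ideal n w) \<subseteq> ?U"
  proof (rule vars_in_degree_subset)
    show "sym_schubert_ideal n w \<subseteq> low_degree_ideal n (c + 1) ?U"
    proof (rule sym_schubert_ideal_subsetI[OF ideal_low_degree_ideal])
      fix i j assume ij: "i \<in> {1..n}" "j \<in> {1..n}"
      let ?r = "schubert_rank n w i j"
      have sub: "{1..i} \<subseteq> {1..n}" "{j..n} \<subseteq> {1..n}" using ij by auto
      show "minors (?r + 1) (cov_submat n {1..i} {j..n}) \<subseteq> low_degree_ideal n (c + 1) ?U"
      proof (cases "?r < i \<and> ?r + j \<le> n")
        case True
        then obtain p m where "p \<in> sym_schubert_ideal n w" "m \<in> Poly_Mapping.keys p" "mon_deg m = ?r + 1"
          using key[OF ij, of 1 n] ij by auto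
        then have "c \<le> ?r" using low by (fastforce simp: low_degree_ideal_def monom_span_def)
        moreover have "cov_vars {1..i} {j..n} \<subseteq> ?U" if "?r = c"
        proof -
          have "(i, j) \<in> rank_corners n w c" using that True ij by (simp add: rank_corners_def)
          then show ?thesis by blast
        qed
        ultimately show ?thesis by (intro minors_subset_low_degree_ideal sub) auto
      next
        case False
        \<comment> \<open>The corner has fewer than \<open>?r + 1\<close> rows or columns.\<close>
        have "minors (?r + 1) (cov_submat n {1..i} {j..n}) = {}"
        proof (rule ccontr)
          assume "minors (?r + 1) (cov_submat n {1..i} {j..n}) \<noteq> {}"
          then obtain p where p: "p \<in> minors (?r + 1) (cov_submat n {1..i} {j..n})" by blast
          obtain f g where f: "inj_on f {..<?r + 1}" "f ` {..<?r + 1} \<subseteq> {1..i}"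
            and g: "inj_on g {..<?r + 1}" "g ` {..<?r + 1} \<subseteq> {j..n}"
            by (rule minors_cov_submatE[OF sub p])
          have "card {..<?r + 1} \<le> card {1..i}" "card {..<?r + 1} \<le> card {j..n}"
            by (rule card_inj_on_le[OF f], simp, rule card_inj_on_le[OF g], simp)
          with False show False by simp
        qed
        then show ?thesis by simp
      qed
    qed
  qed
qed

text \<open>
  Of the \<open>i\<close> ones in the first \<open>i\<close> rows of a permutation matrix, at most \<open>j - 1\<close> lie in the first
  \<open>j - 1\<close> columns.
\<close>

lemma rank_corners_above_diagonal:
  assumes w: "w permutes {1..n}" and ij: "(i, j) \<in> rank_corners n w c"
  shows "i + 1 \<le> c + j"
proof -
  have i: "i \<in> {1..n}" "j \<in> {1..n}" and c: "card {k \<in> {1..i}. w k \<le> n + 1 - j} = c"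
    using ij schubert_rank_eq_card[OF w] by (auto simp: rank_corners_def)
  have "card {k \<in> {1..i}. \<not> w k \<le> n + 1 - j} \<le> card {n + 1 - j<..n}"
  proof (rule card_inj_on_le)
    show "inj_on w {k \<in> {1..i}. \<not> w k \<le> n + 1 - j}"
      using permutes_inj[OF w] by (rule inj_on_subset) simp
    show "w ` {k \<in> {1..i}. \<not> w k \<le> n + 1 - j} \<subseteq> {n + 1 - j<..n}"
    proof
      fix y assume "y \<in> w ` {k \<in> {1..i}. \<not> w k \<le> n + 1 - j}"
      then obtain k where k: "y = w k" "k \<in> {1..i}" "\<not> w k \<le> n + 1 - j" by blast
      then have "w k \<in> {1..n}" using permutes_in_image[OF w, of k] i by auto
      with k show "y \<in> {n + 1 - j<..n}" by auto
    qed
  qed simp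
  moreover have "card {k \<in> {1..i}. w k \<le> n + 1 - j} + card {k \<in> {1..i}. \<not> w k \<le> n + 1 - j} = i"
    by (subst card_Un_disjoint[symmetric]) (auto intro: arg_cong[of _ "{1..i}" card, simplified])
  ultimately show ?thesis using c i by auto
qed

section \<open>Block-shaped sets of indeterminates\<close>

text \<open>
  Every corner \<open>[1, i] \<times> [j, n]\<close> contains \<open>\<sigma> 1 n\<close>, but if it satisfies \<open>i + 1 \<le> c + j\<close> and has more
  than \<open>c\<close> rows and columns, then it contains neither \<open>\<sigma> 1 1\<close> nor \<open>\<sigma> n n\<close>.  So \<open>1\<close> and \<open>n\<close> lie on different sides of the
  statement and not in \<open>C\<close>.  With \<open>1 \<in> A\<close> and \<open>n \<in> B\<close>, the set \<open>B \<union> C\<close> consists of the \<open>y\<close> for which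
  \<open>\<sigma> 1 y\<close> occurs, which is a final segment, and \<open>A \<union> C\<close> of the \<open>x\<close> for which \<open>\<sigma> x n\<close> occurs, which is
  an initial segment; \<open>C\<close> is their intersection.
\<close>

lemma interval_ci_of_cov_vars:
  assumes ci: "ci_statement n A B C"
    and vars: "cov_vars (A \<union> C) (B \<union> C) = (\<Union>(i, j) \<in> X. cov_vars {1..i} {j..n})"
    and X: "\<And>i j. (i, j) \<in> X \<Longrightarrow> i \<in> {1..n} \<and> j \<in> {1..n} \<and> i + 1 \<le> c + j \<and> c < i \<and> c + j \<le> n"
  shows "interval_ci n A B C \<or> interval_ci n B A C"
proof -
  have disj: "A \<inter> B = {}" "A \<inter> C = {}" "B \<inter> C = {}" and sub: "A \<subseteq> {1..n}" "B \<subseteq> {1..n}" "C \<subseteq> {1..n}"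
    and ne: "A \<noteq> {}" "B \<noteq> {}"
    using ci by (auto simp: ci_statement_def)
  have mem': "Upair x y \<in> cov_vars S T \<longleftrightarrow> (x \<in> S \<and> y \<in> T) \<or> (y \<in> S \<and> x \<in> T)" for x y S T
    by (auto simp: cov_vars_def)
  have mem: "Upair x y \<in> cov_vars (A \<union> C) (B \<union> C) \<longleftrightarrow>
      (\<exists>(i, j) \<in> X. (x \<in> {1..i} \<and> y \<in> {j..n}) \<or> (y \<in> {1..i} \<and> x \<in> {j..n}))" for x y
    unfolding vars by (simp only: UN_iff split_def mem')
  obtain a b where "a \<in> A" "b \<in> B" using ne by blast
  then have "X \<noteq> {}" using mem[of a b] by (auto simp: mem')
  then obtain i0 j0 where X0: "(i0, j0) \<in> X" by auto
  have "1 \<notin> C"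
  proof
    assume "1 \<in> C"
    then have "Upair 1 1 \<in> cov_vars (A \<union> C) (B \<union> C)" by (simp add: mem')
    then obtain i j where "(i, j) \<in> X" "1 \<in> {j..n}" unfolding mem by blast
    with X[of i j] show False by auto
  qed
  have "n \<notin> C"
  proof
    assume "n \<in> C"
    then have "Upair n n \<in> cov_vars (A \<union> C) (B \<union> C)" by (simp add: mem')
    then obtain i j where "(i, j) \<in> X" "n \<in> {1..i}" unfolding mem by blast
    with X[of i j] show False by auto
  qed
  have "Upair 1 n \<in> cov_vars (A \<union> C) (B \<union> C)"
    unfolding mem using X0 X[OF X0] by (intro bexI[of _ "(i0, j0)"]) auto
  then have "(1 \<in> A \<and> n \<in> B) \<or> (1 \<in> B \<and> n \<in> A)"
    using \<open>1 \<notin> C\<close> \<open>n \<notin> C\<close> by (auto simp: mem')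
  moreover have "interval_ci n A' B' C" if AB': "1 \<in> A'" "n \<in> B'" "(A', B') = (A, B) \<or> (A', B') = (B, A)" for A' B'
  proof -
    have disj': "A' \<inter> B' = {}" "A' \<inter> C = {}" "B' \<inter> C = {}" and sub': "A' \<subseteq> {1..n}" "B' \<subseteq> {1..n}"
      using disj sub AB'(3) by auto
    have memAB: "Upair x y \<in> cov_vars (A \<union> C) (B \<union> C) \<longleftrightarrow> 
        (x \<in> A' \<union> C \<and> y \<in> B' \<union> C) \<or> (y \<in> A' \<union> C \<and> x \<in> B' \<union> C)" for x y
      using AB'(3) by (auto simp: mem')
    have B: "y \<in> B' \<union> C \<longleftrightarrow> (\<exists>(i, j) \<in> X. j \<le> y \<and> y \<le> n)" for y
    proof
      assume "y \<in> B' \<union> C"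
      then have "Upair 1 y \<in> cov_vars (A \<union> C) (B \<union> C)" using AB' by (simp add: memAB)
      then obtain i j where ij: "(i, j) \<in> X" "y \<in> {j..n} \<or> 1 \<in> {j..n}" unfolding mem by blast
      then show "\<exists>(i, j) \<in> X. j \<le> y \<and> y \<le> n" using X[OF ij(1)] by auto
    next
      assume "\<exists>(i, j) \<in> X. j \<le> y \<and> y \<le> n"
      then obtain i j where ij: "(i, j) \<in> X" "j \<le> y" "y \<le> n" by blast
      have "Upair 1 y \<in> cov_vars (A \<union> C) (B \<union> C)"
        unfolding mem using X[OF ij(1)] ij by (intro bexI[of _ "(i, j)"]) auto
      then show "y \<in> B' \<union> C" using AB' disj' \<open>1 \<notin> C\<close> by (auto simp: memAB)
    qed
    have A: "x \<in> A' \<union> C \<longleftrightarrow> (\<exists>(i, j) \<in> X. 1 \<le> x \<and> x \<le> i)" for x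
    proof
      assume "x \<in> A' \<union> C"
      then have "Upair x n \<in> cov_vars (A \<union> C) (B \<union> C)" using AB' by (simp add: memAB)
      then obtain i j where ij: "(i, j) \<in> X" "x \<in> {1..i} \<or> n \<in> {1..i}" unfolding mem by blast
      then show "\<exists>(i, j) \<in> X. 1 \<le> x \<and> x \<le> i" using X[OF ij(1)] by auto
    next
      assume "\<exists>(i, j) \<in> X. 1 \<le> x \<and> x \<le> i"
      then obtain i j where ij: "(i, j) \<in> X" "1 \<le> x" "x \<le> i" by blast
      have "Upair x n \<in> cov_vars (A \<union> C) (B \<union> C)"
        unfolding mem using X[OF ij(1)] ij by (intro bexI[of _ "(i, j)"]) auto
      then show "x \<in> A' \<union> C" using AB' disj' \<open>n \<notin> C\<close> by (auto simp: memAB)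
    qed
    have "X \<subseteq> {1..n} \<times> {1..n}" using X by auto
    then have finX: "finite X" using finite_subset by blast
    define p q where "p = Max (fst ` X)" and "q = Min (snd ` X)"
    have "p \<in> fst ` X" "q \<in> snd ` X" unfolding p_def q_def using finX X0 by (auto intro: Max_in Min_in)
    moreover have "i \<le> p" "q \<le> j" if "(i, j) \<in> X" for i j
      unfolding p_def q_def using finX that by (force intro: Max_ge Min_le)+
    ultimately have AC: "A' \<union> C = {1..p}" and BC: "B' \<union> C = {q..n}"
      using A B by (auto simp: set_eq_iff; force)+
    have C: "C = {1..p} \<inter> {q..n}" using AC BC disj' by blast
    have A': "A' = {1..p} - C" and B': "B' = {q..n} - C" using AC BC disj' by blast+
    have "1 \<in> {1..p}" "n \<in> {q..n}" unfolding AC[symmetric] BC[symmetric] using AB' by blast+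
    moreover have "1 \<notin> {q..n}" "n \<notin> {1..p}"
      unfolding AC[symmetric] BC[symmetric] using AB' disj' \<open>1 \<notin> C\<close> \<open>n \<notin> C\<close> by blast+
    moreover have "n \<in> {1..n}" using AB'(2) sub'(2) by blast
    ultimately have "1 < q" "p < n" "1 \<le> p" "q \<le> n" by auto
    show ?thesis
    proof (cases "p < q")
      case True
      then have "C = {}" using C by auto
      with True A' B' \<open>1 \<le> p\<close> \<open>p < n\<close> \<open>1 < q\<close> \<open>q \<le> n\<close> show ?thesis
        unfolding interval_ci_def by (intro disjI1 bexI[of _ p] bexI[of _ q]) auto
    next
      case False
      then have "C = {q..p}" using C \<open>1 < q\<close> \<open>p < n\<close> by auto
      moreover have "{1..p} - {q..p} = {1..q - 1}" "{q..n} - {q..p} = {p + 1..n}"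
        using \<open>1 < q\<close> \<open>p < n\<close> False by auto
      ultimately show ?thesis
        unfolding interval_ci_def using A' B' \<open>1 < q\<close> \<open>p < n\<close> False
        by (intro disjI2 bexI[of _ "q - 1"] bexI[of _ "p + 1"]) auto
    qed
  qed
  ultimately show ?thesis by blast
qed

section \<open>Schubert conditional independence ideals\<close>

theorem proposition4p1:
  fixes n :: nat and A B C :: "nat set"
  assumes "ci_statement n A B C"
  shows "is_sym_schubert_ideal n (ci_ideal n A B C)
           \<longleftrightarrow> interval_ci n A B C \<or> interval_ci n B A C"
proof
  assume "is_sym_schubert_ideal n (ci_ideal n A B C)"
  then obtain w where w: "w permutes {1..n}" and eq: "ci_ideal n A B C = sym_schubert_ideal n w"
    by (auto simp: is_sym_schubert_ideal_def)
  have "cov_vars (A \<union> C) (B \<union> C) = (\<Union>(i, j) \<in> rank_corners n w (card C). cov_vars {1..i} {j..n})"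
    using vars_in_degree_ci_ideal[OF assms] ci_ideal_subset_low_degree[OF assms]
      vars_in_degree_sym_schubert_ideal[of n w "card C"] by (simp add: eq)
  then show "interval_ci n A B C \<or> interval_ci n B A C"
  proof (rule interval_ci_of_cov_vars[OF assms])
    fix i j assume ij: "(i, j) \<in> rank_corners n w (card C)"
    then show "i \<in> {1..n} \<and> j \<in> {1..n} \<and> i + 1 \<le> card C + j \<and> card C < i \<and> card C + j \<le> n"
      using rank_corners_above_diagonal[OF w ij] by (simp add: rank_corners_def)
  qed
next
  assume "interval_ci n A B C \<or> interval_ci n B A C"
  moreover have "ci_ideal n A B C = ci_ideal n B A C"
    using assms by (intro ci_ideal_commute) (auto simp: ci_statement_def)
  ultimately show "is_sym_schubert_ideal n (ci_ideal n A B C)"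
    using interval_ci_is_sym_schubert_ideal by metis
qed

end
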